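(* Let $\phi$ be a discrete-time STL formula in strict normal form. Then the complete tableau (with the JUMP rule) for $\phi$ is a finite tree.
   Context: Discrete-time STL. Fix a finite set $S=\{x_1,\dots,x_n\}$ of real-valued signal variables; a signal is a function $w:\mathbb{N}\to\mathbb{R}^n$, and $w_R$ denotes its projection on $R\subseteq S$. Atomic constraints are $f(R)=k$ and $f(R)>k$ with $R\subseteq S$, $f:\mathbb{R}^{|R|}\to\mathbb{R}$ linear, $k\in\mathbb{Q}$. Terms are $\top$, atomic constraints, and their negations. The strict until and strict release operators, for $a\le b$ in $\mathbb{N}$, have semantics: $(w,t)\models \psi_1\,\mathsf{sU}_{[a,b]}\,\psi_2$ iff there is $t'\in[t+a,t+b]$ with $(w,t')\models\psi_2$ and $(w,t'')\models\psi_1$ for all $t''\in[t+a,t'-1]$; $(w,t)\models \psi_1\,\mathsf{sR}_{[a,b]}\,\psi_2$ iff for all $t'\in[t+a,t+b]$, $(w,t')\models\psi_2$ or there is $t''\in[t+a,t'-1]$ with $(w,t'')\models\psi_1$. A formula is in strict normal form if it is built from terms using only $\wedge,\vee,\mathsf{sU},\mathsf{sR}$. For a temporal operator $\psi$ with interval $[a,b]$ write $I_\ell(\psi)=a$, $I_u(\psi)=b$. The propositional closure is $\mathrm{pcl}(\neg\psi_1)=\{\psi_1\}$, $\mathrm{pcl}(\psi_1\wedge\psi_2)=\mathrm{pcl}(\psi_1\vee\psi_2)=\{\psi_1,\psi_2\}$, $\mathrm{pcl}(\psi)=\{\psi\}$ for a temporal operator $\psi$. Tableau. In node labels, a temporal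 operator occurrence $\psi_1\,\mathsf{B}_I\,\psi_2$ ($\mathsf{B}\in\{\mathsf{sU},\mathsf{sR}\}$) carries a superscript interval $J$ (written $\psi_1\,\mathsf{B}^J_I\,\psi_2$) and may be marked (written $\overline{\mathsf{B}}$). For an interval $I$ and $t\in\mathbb{N}$, the temporal expansion $\exp^t_I$ is the identity on terms, commutes with $\neg,\wedge,\vee$, and maps $\psi_1\,\mathsf{B}_{[a,b]}\,\psi_2$ to $\psi_1\,\mathsf{B}^I_{[a+t,b+t]}\,\psi_2$ (arguments unchanged). Each node $u$ has a finite set of formulas $\Gamma(u)$ and a time $t(u)\in\mathbb{N}$. The root has $t=0$ and label $\{\phi\}$, where the temporal operators of $\phi$ not nested in other temporal operators get superscript $[-1,-1]$. Rules: (Expansion) If $\Gamma(u)$ contains a formula $\psi$ of one of the following forms, pick such a $\psi$ and create children $u_1$ (and $u_2$) with the same time and $\Gamma(u_i)=(\Gamma(u)\setminus\{\psi\})\cup\Gamma_i$: for $\psi=\psi_1\vee\psi_2$: $\Gamma_1=\{\psi_1\}$, $\Gamma_2=\{\psi_2\}$; for $\psi=\psi_1\wedge\psi_2$: a single child with $\Gamma_1=\{\psi_1,\psi_2\}$; for unmarked $\psi=\psi_1\,\mathsf{sU}^J_I\,\psi_2$ with $t(u)\in I$: $\Gamma_1=\{\exp^{t(u)}_I(\psi_2)\}$, $\Gamma_2=\{\exp^{t(u)}_I(\psi_1),\ \psi_1\,\overline{\mathsf{sU}}^J_I\,\psi_2\}$; for unmarked $\psi=\psi_1\,\mathsf{sR}^J_I\,\psi_2$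 with $t(u)\in I$: $\Gamma_1=\{\exp^{t(u)}_I(\psi_1\wedge\psi_2)\}$, $\Gamma_2=\{\exp^{t(u)}_I(\psi_2),\ \psi_1\,\overline{\mathsf{sR}}^J_I\,\psi_2\}$. A node to which no expansion rule applies is poised. A poised $u$ is rejected if $\neg\top\in\Gamma(u)$; or if the set of atomic constraints and negated atomic constraints in $\Gamma(u)$ is unsatisfiable over the reals; or if $\Gamma(u)$ contains a marked $\psi_1\,\overline{\mathsf{sU}}^J_{[a,b]}\,\psi_2$ with $b=t(u)$. Otherwise it is accepted if $\Gamma(u)$ contains no temporal operators. Accepted and rejected nodes are leaves. Any other poised node gets one child $u'$ by STEP or JUMP: STEP applies iff $\Gamma(u)$ contains a marked $\psi_1\,\overline{\mathsf{sU}}^J_{[a,b]}\,\psi_2$ (resp. $\psi_2\,\overline{\mathsf{sR}}^J_{[a,b]}\,\psi_1$) with $t(u)\notin J$ such that $t(u)=b$ or some temporal operator $\chi\in\mathrm{pcl}(\psi_1)$ satisfies $t(u)<a+I_u(\chi)$. Then $t(u')=t(u)+1$ and $\Gamma(u')$ consists of the unmarked temporal operators of $\Gamma(u)$ and the unmarked copies (same superscript and interval) of the marked operators $\psi_1\,\overline{\mathsf{B}}^J_{[a,b]}\,\psi_2\in\Gamma(u)$ with $t(u)<b$. JUMP applies otherwise. Let $K(u)$ be the set of all $a,b$ such that some (marked or unmarked) $\psi_1\,\mathsf{B}^J_{[a,b]}\,\psi_2\in\Gamma(u)$ has $t(u)\notin J$. Then $t(u')=\min\{t\in K(u)\mid t>t(u)\}$,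 $k=t(u')-t(u)$, and $\Gamma(u')$ is the union of: unmarked $\psi_1\,\mathsf{B}^J_I\,\psi_2\in\Gamma(u)$ with $t(u)\notin J$ (unchanged); $\psi_1\,\mathsf{B}^J_{[a+k,b+k]}\,\psi_2$ for each unmarked $\psi_1\,\mathsf{B}^J_{[a,b]}\,\psi_2\in\Gamma(u)$ with $t(u)\in J$; the unmarked $\psi_1\,\mathsf{B}^J_{[a,b]}\,\psi_2$ for each marked $\psi_1\,\overline{\mathsf{B}}^J_{[a,b]}\,\psi_2\in\Gamma(u)$ with $t(u)\notin J$ and $t(u)<b$; and the unmarked $\psi_1\,\mathsf{B}^J_{[a+k,b+k]}\,\psi_2$ for each marked $\psi_1\,\overline{\mathsf{B}}^J_{[a,b]}\,\psi_2\in\Gamma(u)$ with $t(u)\in J$ and $t(u)<b$. The complete tableau is obtained by applying these rules until no rule applies to any leaf.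
   Formalization: JUMP is taken to apply only if some t in K(u) exceeds t(u); otherwise the minimum defining t(u') does not exist (e.g. first child of the root for ⊤ sU[0,5] (⊤ sU[1,2] p), where K(u) is empty), and the node is treated as a leaf. *)

theory Defs
  imports "HOL-Analysis.Analysis"
begin

text \<open>
  The signal variables are the elements of a finite type \<open>'n\<close>, so a signal sample is a vector
  of type \<open>real ^ 'n\<close>. The domain \<open>\<real>\<^sup>R\<close> of the function of an atomic constraint is embedded into
  \<open>real ^ 'n\<close> by padding with zeros outside \<open>R\<close>; every linear function on \<open>\<real>\<^sup>R\<close> is the restriction
  of a linear function on \<open>real ^ 'n\<close>.
\<close>

definition proj :: "'n::finite set \<Rightarrow> real ^ 'n \<Rightarrow> real ^ 'n" where
  "proj R v = (\<chi> i. if i \<in> R then v $ i else 0)"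

datatype ('n::finite) atom =
    AEq "real ^ 'n \<Rightarrow> real" "'n set" rat
  | AGt "real ^ 'n \<Rightarrow> real" "'n set" rat

fun atom_linear :: "'n::finite atom \<Rightarrow> bool" where
  "atom_linear (AEq f R k) = linear f"
| "atom_linear (AGt f R k) = linear f"

fun atom_sat :: "real ^ 'n \<Rightarrow> 'n::finite atom \<Rightarrow> bool" where
  "atom_sat v (AEq f R k) \<longleftrightarrow> f (proj R v) = of_rat k"
| "atom_sat v (AGt f R k) \<longleftrightarrow> f (proj R v) > of_rat k"

datatype temp_op = SU | SR

text \<open>\<open>FTemp B a b p q\<close> is the formula \<open>p B\<close>-with-interval-\<open>[a,b] q\<close>, for \<open>B\<close> strict until or
  strict release.\<close>

datatype ('n::finite) stl =
    FTop
  | FAtom "'n atom"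
  | FNot "'n stl"
  | FAnd "'n stl" "'n stl"
  | FOr "'n stl" "'n stl"
  | FTemp temp_op nat nat "'n stl" "'n stl"

fun stl_wf :: "'n::finite stl \<Rightarrow> bool" where
  "stl_wf FTop = True"
| "stl_wf (FAtom \<alpha>) = atom_linear \<alpha>"
| "stl_wf (FNot p) = stl_wf p"
| "stl_wf (FAnd p q) = (stl_wf p \<and> stl_wf q)"
| "stl_wf (FOr p q) = (stl_wf p \<and> stl_wf q)"
| "stl_wf (FTemp B a b p q) = (a \<le> b \<and> stl_wf p \<and> stl_wf q)"

fun strict_normal_form :: "'n::finite stl \<Rightarrow> bool" where
  "strict_normal_form FTop = True"
| "strict_normal_form (FAtom \<alpha>) = True"
| "strict_normal_form (FNot p) = (p = FTop \<or> (\<exists>\<alpha>. p = FAtom \<alpha>))"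
| "strict_normal_form (FAnd p q) = (strict_normal_form p \<and> strict_normal_form q)"
| "strict_normal_form (FOr p q) = (strict_normal_form p \<and> strict_normal_form q)"
| "strict_normal_form (FTemp B a b p q) = (strict_normal_form p \<and> strict_normal_form q)"

text \<open>Terms get no propositional closure in the mathematical definition; only the temporal
  operators in the closure are ever used, so the empty set is a harmless default.\<close>

fun pcl :: "'n::finite stl \<Rightarrow> 'n stl set" where
  "pcl (FNot p) = {p}"
| "pcl (FAnd p q) = {p, q}"
| "pcl (FOr p q) = {p, q}"
| "pcl (FTemp B a b p q) = {FTemp B a b p q}"
| "pcl _ = {}"

text \<open>
  Formulas in node labels. In \<open>NTemp m B J a b p q\<close> the flag \<open>m\<close> says whether the operator is marked
  and \<open>J\<close> holds the end points of the superscript, which are integers because of the superscript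
  \<open>[-1,-1]\<close> at the root. The arguments are plain formulas, since superscripts and marks occur only
  on temporal operators that are not nested in others.
\<close>

datatype ('n::finite) nstl =
    NTop
  | NAtom "'n atom"
  | NNot "'n nstl"
  | NAnd "'n nstl" "'n nstl"
  | NOr "'n nstl" "'n nstl"
  | NTemp bool temp_op "int \<times> int" nat nat "'n stl" "'n stl"

fun temp_exp :: "int \<times> int \<Rightarrow> nat \<Rightarrow> 'n::finite stl \<Rightarrow> 'n nstl" where
  "temp_exp J t FTop = NTop"
| "temp_exp J t (FAtom \<alpha>) = NAtom \<alpha>"
| "temp_exp J t (FNot p) = NNot (temp_exp J t p)"
| "temp_exp J t (FAnd p q) = NAnd (temp_exp J t p) (temp_exp J t q)"
| "temp_exp J t (FOr p q) = NOr (temp_exp J t p) (temp_exp J t q)"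
| "temp_exp J t (FTemp B a b p q) = NTemp False B J (a + t) (b + t) p q"

definition in_sup :: "nat \<Rightarrow> int \<times> int \<Rightarrow> bool" where
  "in_sup t J \<longleftrightarrow> fst J \<le> int t \<and> int t \<le> snd J"

type_synonym 'n node = "'n nstl set \<times> nat"

text \<open>At time 0 the temporal expansion shifts nothing, so it just attaches the superscript.\<close>

definition root_node :: "'n::finite stl \<Rightarrow> 'n node" where
  "root_node \<phi> = ({temp_exp (-1, -1) 0 \<phi>}, 0)"

text \<open>The sets \<open>\<Gamma>\<^sub>i\<close> of the expansion rule for a formula; the list is empty if
  the rule does not apply to it.\<close>

fun expansion :: "nat \<Rightarrow> 'n::finite nstl \<Rightarrow> 'n nstl set list" where
  "expansion t (NOr p q) = [{p}, {q}]"
| "expansion t (NAnd p q) = [{p, q}]"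
| "expansion t (NTemp False SU J a b p q) =
    (if a \<le> t \<and> t \<le> b
     then [{temp_exp (int a, int b) t q},
           {temp_exp (int a, int b) t p, NTemp True SU J a b p q}]
     else [])"
| "expansion t (NTemp False SR J a b p q) =
    (if a \<le> t \<and> t \<le> b
     then [{temp_exp (int a, int b) t (FAnd p q)},
           {temp_exp (int a, int b) t q, NTemp True SR J a b p q}]
     else [])"
| "expansion t _ = []"

definition poised :: "'n::finite node \<Rightarrow> bool" where
  "poised = (\<lambda>(\<Gamma>, t). \<forall>\<psi>\<in>\<Gamma>. expansion t \<psi> = [])"

definition rejected :: "'n::finite node \<Rightarrow> bool" where
  "rejected = (\<lambda>(\<Gamma>, t).
     NNot NTop \<in> \<Gamma>
   \<or> \<not> (\<exists>v. (\<forall>\<alpha>. NAtom \<alpha> \<in> \<Gamma> \<longrightarrow> atom_sat v \<alpha>)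
          \<and> (\<forall>\<alpha>. NNot (NAtom \<alpha>) \<in> \<Gamma> \<longrightarrow> \<not> atom_sat v \<alpha>))
   \<or> (\<exists>J a p q. NTemp True SU J a t p q \<in> \<Gamma>))"

definition accepted :: "'n::finite node \<Rightarrow> bool" where
  "accepted = (\<lambda>(\<Gamma>, t).
     \<not> rejected (\<Gamma>, t) \<and> \<not> (\<exists>m B J a b p q. NTemp m B J a b p q \<in> \<Gamma>))"

definition step_applies :: "'n::finite node \<Rightarrow> bool" where
  "step_applies = (\<lambda>(\<Gamma>, t).
     \<exists>B J a b p q. NTemp True B J a b p q \<in> \<Gamma> \<and> \<not> in_sup t J \<and>
       (t = b \<or> (\<exists>B' a' b' p' q'.
          FTemp B' a' b' p' q' \<in> pcl (case B of SU \<Rightarrow> p | SR \<Rightarrow> q) \<and> t < a + b')))"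

definition step_node :: "'n::finite node \<Rightarrow> 'n node" where
  "step_node = (\<lambda>(\<Gamma>, t).
     ({NTemp False B J a b p q | B J a b p q.
         NTemp False B J a b p q \<in> \<Gamma> \<or> NTemp True B J a b p q \<in> \<Gamma> \<and> t < b},
      t + 1))"

definition jump_times :: "'n::finite node \<Rightarrow> nat set" where
  "jump_times = (\<lambda>(\<Gamma>, t).
     {c. \<exists>m B J a b p q. NTemp m B J a b p q \<in> \<Gamma> \<and> \<not> in_sup t J \<and> (c = a \<or> c = b)})"

definition jump_node :: "'n::finite node \<Rightarrow> 'n node" where
  "jump_node = (\<lambda>(\<Gamma>, t).
     let t' = Min {c \<in> jump_times (\<Gamma>, t). t < c}; k = t' - t in
     ({NTemp False B J a b p q | B J a b p q. NTemp False B J a b p q \<in> \<Gamma> \<and> \<not> in_sup t J}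
      \<union> {NTemp False B J (a + k) (b + k) p q | B J a b p q.
           NTemp False B J a b p q \<in> \<Gamma> \<and> in_sup t J}
      \<union> {NTemp False B J a b p q | B J a b p q.
           NTemp True B J a b p q \<in> \<Gamma> \<and> \<not> in_sup t J \<and> t < b}
      \<union> {NTemp False B J (a + k) (b + k) p q | B J a b p q.
           NTemp True B J a b p q \<in> \<Gamma> \<and> in_sup t J \<and> t < b},
      t'))"

text \<open>
  \<open>children u cs\<close>: the list \<open>cs\<close> is a possible list of children of \<open>u\<close>. It is a relation because
  the expansion rule picks an arbitrary expandable formula. The jump rule is applicable only if
  there is a time to jump to: otherwise the minimum defining the time of the child does not exist,
  no rule applies, and the node is a leaf (this happens, for instance, if the superscripts
  of all operators in the label contain the current time).
\<close>

definition children :: "'n::finite node \<Rightarrow> 'n node list \<Rightarrow> bool" where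
  "children = (\<lambda>(\<Gamma>, t) cs.
     if \<not> poised (\<Gamma>, t) then
       \<exists>\<psi>\<in>\<Gamma>. expansion t \<psi> \<noteq> [] \<and> cs = map (\<lambda>\<Delta>. ((\<Gamma> - {\<psi>}) \<union> \<Delta>, t)) (expansion t \<psi>)
     else if rejected (\<Gamma>, t) \<or> accepted (\<Gamma>, t) then cs = []
     else if step_applies (\<Gamma>, t) then cs = [step_node (\<Gamma>, t)]
     else if \<exists>c \<in> jump_times (\<Gamma>, t). t < c then cs = [jump_node (\<Gamma>, t)]
     else cs = [])"

text \<open>
  A possibly infinite labelled tree is given by its set \<open>N\<close> of positions (a position is the list of
  child indices on the path from the root) and a labelling \<open>L\<close> of positions by nodes. It is
  a complete tableau if the children of each position arise from the applicable rule, so that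
  no rule is applicable at the leaves.
\<close>

definition complete_tableau ::
  "'n::finite stl \<Rightarrow> nat list set \<Rightarrow> (nat list \<Rightarrow> 'n node) \<Rightarrow> bool" where
  "complete_tableau \<phi> N L \<longleftrightarrow>
     [] \<in> N \<and> L [] = root_node \<phi> \<and>
     (\<forall>p i. p @ [i] \<in> N \<longrightarrow> p \<in> N) \<and>
     (\<forall>p\<in>N. \<exists>cs. children (L p) cs \<and>
        (\<forall>i. p @ [i] \<in> N \<longleftrightarrow> i < length cs) \<and>
        (\<forall>i<length cs. L (p @ [i]) = cs ! i))"

lemma children_total: "\<exists>cs. children u cs"
proof (cases u)
  case (Pair \<Gamma> t)
  show ?thesis
  proof (cases "poised u")
    case True
    then show ?thesis unfolding Pair children_def
      by (cases "rejected (\<Gamma>, t) \<or> accepted (\<Gamma>, t)";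
          cases "step_applies (\<Gamma>, t)";
          cases "\<exists>c \<in> jump_times (\<Gamma>, t). t < c") simp_all
  next
    case False
    then obtain \<psi> where "\<psi> \<in> \<Gamma>" "expansion t \<psi> \<noteq> []"
      unfolding Pair poised_def by auto
    with False show ?thesis unfolding Pair children_def by auto
  qed
qed

fun walk :: "('a \<Rightarrow> 'a list) \<Rightarrow> 'a \<Rightarrow> nat list \<Rightarrow> 'a option" where
  "walk c u [] = Some u"
| "walk c u (i # p) = (if i < length (c u) then walk c (c u ! i) p else None)"

lemma walk_snoc:
  "walk c u (p @ [i]) =
     (case walk c u p of None \<Rightarrow> None
      | Some v \<Rightarrow> if i < length (c v) then Some (c v ! i) else None)"
  by (induction p arbitrary: u) auto

lemma complete_tableau_exists:
  fixes \<phi> :: "'n::finite stl"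
  shows "\<exists>N L. complete_tableau \<phi> N L"
proof -
  obtain c :: "'n node \<Rightarrow> 'n node list" where c: "\<And>u. children u (c u)"
    using children_total by metis
  let ?w = "walk c (root_node \<phi>)"
  have "complete_tableau \<phi> {p. ?w p \<noteq> None} (\<lambda>p. the (?w p))"
    unfolding complete_tableau_def
  proof (intro conjI ballI)
    show "\<forall>p i. p @ [i] \<in> {p. ?w p \<noteq> None} \<longrightarrow> p \<in> {p. ?w p \<noteq> None}"
      by (auto simp: walk_snoc split: option.splits)
  next
    fix p assume "p \<in> {p. ?w p \<noteq> None}"
    then obtain v where "?w p = Some v" by auto
    then show "\<exists>cs. children (the (?w p)) cs \<and>
        (\<forall>i. p @ [i] \<in> {p. ?w p \<noteq> None} \<longleftrightarrow> i < length cs) \<and>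
        (\<forall>i<length cs. the (?w (p @ [i])) = cs ! i)"
      using c[of v] by (intro exI[of _ "c v"]) (auto simp: walk_snoc)
  qed auto
  then show ?thesis by blast
qed

end

theory Submission
  imports Defs
begin

text \<open>
  Every node has at most two children, so an infinite tableau has an infinite branch. Between
  two time steps the expansion rule decreases the total weight of the label, so time tends to
  infinity along such a branch. By induction from the largest operators downwards, all
  operators of a given weight eventually lie in the past: once the larger ones are past, no
  new operators of this weight appear, the superscripts of those present are bounded, and an
  operator whose superscript is past is not shifted any more. When all operators are past,
  neither STEP nor JUMP applies.
\<close>

section \<open>Weights, operator data and the node invariant\<close>

fun stl_weight :: "'n::finite stl \<Rightarrow> nat" where
  "stl_weight FTop = 1"
| "stl_weight (FAtom \<alpha>) = 1"
| "stl_weight (FNot p) = stl_weight p + 1"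
| "stl_weight (FAnd p q) = stl_weight p + stl_weight q + 1"
| "stl_weight (FOr p q) = stl_weight p + stl_weight q + 1"
| "stl_weight (FTemp B a b p q) = stl_weight p + stl_weight q + 2"

fun weight :: "'n::finite nstl \<Rightarrow> nat" where
  "weight NTop = 1"
| "weight (NAtom \<alpha>) = 1"
| "weight (NNot p) = weight p + 1"
| "weight (NAnd p q) = weight p + weight q + 1"
| "weight (NOr p q) = weight p + weight q + 1"
| "weight (NTemp m B J a b p q) = (if m then 1 else stl_weight p + stl_weight q + 2)"

text \<open>Operators below a negation are left out, because no rule ever uncovers them.\<close>

fun ops :: "'n::finite nstl \<Rightarrow> (bool \<times> (int \<times> int) \<times> nat \<times> nat \<times> nat) set" where
  "ops (NAnd p q) = ops p \<union> ops q"
| "ops (NOr p q) = ops p \<union> ops q"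
| "ops (NTemp m B J a b p q) = {(m, J, a, b, stl_weight p + stl_weight q)}"
| "ops _ = {}"

text \<open>Serves finiteness: the labels built by STEP and JUMP are covered by images of the old
  label under such maps.\<close>

fun unmark_shift :: "nat \<Rightarrow> 'n::finite nstl \<Rightarrow> 'n nstl" where
  "unmark_shift k (NTemp m B J a b p q) = NTemp False B J (a + k) (b + k) p q"
| "unmark_shift k \<psi> = \<psi>"

text \<open>In an entry \<open>(m, J, a, b, d)\<close> the arguments survive only through their
  total weight \<open>d\<close>, the rank for the downward induction on operators.\<close>

definition node_ops :: "'n::finite node \<Rightarrow> (bool \<times> (int \<times> int) \<times> nat \<times> nat \<times> nat) set" where
  "node_ops u = (\<Union>\<psi>\<in>fst u. ops \<psi>)"

definition node_weight :: "'n::finite node \<Rightarrow> nat" where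
  "node_weight u = (\<Sum>\<psi>\<in>fst u. weight \<psi>)"

text \<open>The condition on marked operators keeps them from lying in the past, which later
  excludes STEP.\<close>

definition tableau_node :: "'n::finite node \<Rightarrow> bool" where
  "tableau_node u \<longleftrightarrow> finite (fst u) \<and>
     (\<forall>J a b d. (True, J, a, b, d) \<in> node_ops u \<longrightarrow> a \<le> snd u \<and> snd u \<le> b)"

definition child :: "'n::finite node \<Rightarrow> 'n node \<Rightarrow> bool" where
  "child u v \<longleftrightarrow> (\<exists>cs. children u cs \<and> v \<in> set cs)"

section \<open>Weight and operators under expansion\<close>

lemma finite_ops: "finite (ops \<psi>)"
  by (induction \<psi>) auto

lemma finite_node_ops: "finite (fst u) \<Longrightarrow> finite (node_ops u)"
  by (simp add: node_ops_def finite_ops)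

lemma node_opsI:
  "NTemp m B J a b p q \<in> \<Gamma> \<Longrightarrow>
    (m, J, a, b, stl_weight p + stl_weight q) \<in> node_ops (\<Gamma>, t)"
  unfolding node_ops_def by force

lemma weight_temp_exp: "weight (temp_exp J t p) = stl_weight p"
  by (induction p) auto

lemma ops_temp_exp:
  "(m, J', a, b, d) \<in> ops (temp_exp J t p) \<Longrightarrow> \<not> m \<and> J' = J \<and> d < stl_weight p"
  by (induction p) auto

text \<open>The summand 2 in the weight of an operator is chosen for \<open>SR\<close>: the
  conjunction of its arguments still weighs one less than the operator. A marked copy costs only
  1.\<close>

lemma expansion_weight:
  assumes "\<Delta> \<in> set (expansion t \<psi>)"
  shows "finite \<Delta> \<and> sum weight \<Delta> < weight \<psi>"
  using assms
  by (induction t \<psi> rule: expansion.induct)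
    (auto simp: weight_temp_exp sum.insert_if split: if_splits)

text \<open>Expansion either keeps an operator, perhaps marking it, or uncovers one of smaller rank
  inside an argument. In the latter case the expanded operator is not yet past, since its interval
  contains \<open>t\<close>.\<close>

lemma expansion_ops:
  assumes "\<Delta> \<in> set (expansion t \<psi>)" "\<xi> \<in> \<Delta>" "(m', J, a', b', d) \<in> ops \<xi>"
  shows "(\<exists>m. (m, J, a', b', d) \<in> ops \<psi> \<and> (m' \<longrightarrow> m \<or> a' \<le> t \<and> t \<le> b')) \<or>
    \<not> m' \<and> (\<exists>m J\<^sub>2 a b d\<^sub>2. (m, J\<^sub>2, a, b, d\<^sub>2) \<in> ops \<psi> \<and> d < d\<^sub>2 \<and> a \<le> t \<and> t \<le> b)"
proof (cases \<psi>)
  case (NTemp m B K a b p q)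
  have "a \<le> t \<and> t \<le> b"
    using assms(1) NTemp by (cases m; cases B) (auto split: if_splits)
  moreover have "(m', J, a', b', d) = (True, K, a, b, stl_weight p + stl_weight q) \<or>
      \<not> m' \<and> d < stl_weight p + stl_weight q"
    using assms NTemp by (cases m; cases B) (auto split: if_splits dest!: ops_temp_exp)
  ultimately show ?thesis
    by (elim disjE) (simp_all add: NTemp)
qed (use assms in auto)

section \<open>Effect of one rule on time and operators\<close>

lemma child_cases:
  assumes "child u v"
  obtains (expand) \<psi> \<Delta> where "\<psi> \<in> fst u" "\<Delta> \<in> set (expansion (snd u) \<psi>)"
      "v = (fst u - {\<psi>} \<union> \<Delta>, snd u)"
  | (step) "step_applies u" "v = step_node u"
  | (jump) "\<exists>c\<in>jump_times u. snd u < c" "v = jump_node u"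
  using assms unfolding child_def children_def
  by (cases u) (fastforce split: if_splits)

lemma unmark_shift_image:
  "NTemp m B J a b p q \<in> \<Gamma> \<Longrightarrow>
    NTemp False B J (a + k) (b + k) p q \<in> unmark_shift k ` \<Gamma>"
  by (metis imageI unmark_shift.simps(1))

lemma step_node_subset: "fst (step_node (\<Gamma>, t)) \<subseteq> unmark_shift 0 ` \<Gamma>"
  unfolding step_node_def by (auto dest: unmark_shift_image[where k = 0])

lemma jump_node_subset:
  "fst (jump_node (\<Gamma>, t)) \<subseteq> unmark_shift 0 ` \<Gamma> \<union>
    unmark_shift (Min {c \<in> jump_times (\<Gamma>, t). t < c} - t) ` \<Gamma>"
  unfolding jump_node_def Let_def
  by (auto simp: unmark_shift_image dest: unmark_shift_image[where k = 0])

text \<open>Ensures that the \<open>Min\<close> in \<open>jump_node\<close> is attained.\<close>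

lemma finite_jump_times:
  assumes "finite (fst u)"
  shows "finite (jump_times u)"
proof -
  obtain \<Gamma> t where u: "u = (\<Gamma>, t)" by fastforce
  let ?fst = "\<lambda>(m, J, a, b, d). a" and ?snd = "\<lambda>(m, J, a, b, d). b"
  have "c \<in> ?fst ` node_ops u \<union> ?snd ` node_ops u" if "c \<in> jump_times u" for c
  proof -
    from that obtain m B J a b p q where op: "NTemp m B J a b p q \<in> \<Gamma>" "c = a \<or> c = b"
      unfolding u jump_times_def prod.case by blast
    have "(m, J, a, b, stl_weight p + stl_weight q) \<in> node_ops u"
      unfolding u by (rule node_opsI[OF op(1)])
    then have "a \<in> ?fst ` node_ops u" "b \<in> ?snd ` node_ops u"
      by (rule image_eqI[rotated], simp)+
    then show ?thesis using op(2) by blast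
  qed
  then have "jump_times u \<subseteq> ?fst ` node_ops u \<union> ?snd ` node_ops u" by blast
  then show ?thesis
    by (rule finite_subset) (simp add: finite_node_ops[OF assms])
qed

lemma jump_node_time:
  assumes "finite (fst u)" "\<exists>c\<in>jump_times u. snd u < c"
  shows "snd u < snd (jump_node u)"
proof -
  let ?C = "{c \<in> jump_times u. snd u < c}"
  have "Min ?C \<in> ?C"
    using assms finite_jump_times[OF assms(1)] by (intro Min_in) auto
  then show ?thesis
    by (cases u) (simp add: jump_node_def Let_def)
qed

lemma step_node_ops:
  assumes "(m', J, a', b', d) \<in> node_ops (step_node u)"
  shows "\<not> m' \<and> (\<exists>m. (m, J, a', b', d) \<in> node_ops u)"
proof -
  obtain \<Gamma> t where u: "u = (\<Gamma>, t)" by fastforce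
  obtain \<xi> where "\<xi> \<in> fst (step_node u)" "(m', J, a', b', d) \<in> ops \<xi>"
    using assms by (auto simp: node_ops_def)
  then show ?thesis
    unfolding u step_node_def by (auto; blast intro: node_opsI)
qed

lemma jump_node_ops:
  assumes "(m', J, a', b', d) \<in> node_ops (jump_node u)"
  shows "\<not> m' \<and> (\<exists>m a b. (m, J, a, b, d) \<in> node_ops u \<and>
    (in_sup (snd u) J \<or> a' = a \<and> b' = b))"
proof -
  obtain \<Gamma> t where u: "u = (\<Gamma>, t)" by fastforce
  obtain \<xi> where "\<xi> \<in> fst (jump_node u)" "(m', J, a', b', d) \<in> ops \<xi>"
    using assms by (auto simp: node_ops_def)
  then show ?thesis
    unfolding u jump_node_def Let_def
    by (auto; blast intro: node_opsI)
qed

text \<open>Lexicographic progress: expansion consumes weight at constant time, STEP and JUMP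
  advance time.\<close>

lemma child_time:
  assumes "child u v" "finite (fst u)"
  shows "snd u < snd v \<or> snd v = snd u \<and> node_weight v < node_weight u"
  using assms(1)
proof (cases rule: child_cases)
  case (expand \<psi> \<Delta>)
  \<comment> \<open>Only an inequality, because formulas of \<open>\<Delta>\<close> may already be
    in the label.\<close>
  have "node_weight v \<le> sum weight (fst u - {\<psi>}) + sum weight \<Delta>"
    using expand by (simp add: node_weight_def assms(2) expansion_weight sum_Un_nat)
  also have "\<dots> < sum weight (fst u - {\<psi>}) + weight \<psi>"
    using expansion_weight[OF expand(2)] by simp
  also have "\<dots> = node_weight u"
    using expand assms(2) by (simp add: node_weight_def sum.remove)
  finally show ?thesis
    using expand by simp
next
  case step
  then show ?thesis by (cases u) (simp add: step_node_def)
next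
  case jump
  then show ?thesis using jump_node_time[OF assms(2)] by simp
qed

text \<open>Traces an operator back to the parent. The second alternative becomes impossible once
  all operators of larger rank are past; the first keeps superscript and rank.\<close>

lemma child_ops:
  assumes "child u v" "(m', J, a', b', d) \<in> node_ops v"
  shows "(\<exists>m a b. (m, J, a, b, d) \<in> node_ops u \<and> (in_sup (snd u) J \<or> a' = a \<and> b' = b)) \<or>
    (\<exists>m J\<^sub>2 a b d\<^sub>2. (m, J\<^sub>2, a, b, d\<^sub>2) \<in> node_ops u \<and> d < d\<^sub>2 \<and> a \<le> snd u \<and> snd u \<le> b)"
  using assms(1)
proof (cases rule: child_cases)
  case (expand \<psi> \<Delta>)
  from assms(2) expand(3) obtain \<xi>
    where \<xi>: "\<xi> \<in> fst u \<or> \<xi> \<in> \<Delta>" "(m', J, a', b', d) \<in> ops \<xi>"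
    by (auto simp: node_ops_def)
  show ?thesis
  proof (cases "\<xi> \<in> fst u")
    case True
    with \<xi>(2) show ?thesis by (auto simp: node_ops_def)
  next
    case False
    with \<xi> have "\<xi> \<in> \<Delta>" by simp
    have "ops \<psi> \<subseteq> node_ops u" using expand(1) by (auto simp: node_ops_def)
    with expansion_ops[OF expand(2) \<open>\<xi> \<in> \<Delta>\<close> \<xi>(2)] show ?thesis
      by (elim disjE exE conjE) (drule (1) subsetD, blast)+
  qed
next
  case step
  then show ?thesis using step_node_ops[of m' J a' b' d u] assms(2) by blast
next
  case jump
  then show ?thesis using jump_node_ops[of m' J a' b' d u] assms(2) by blast
qed

text \<open>Expansion marks an operator only while the time is in its interval, and leaves the time
  fixed; STEP and JUMP remove all marks.\<close>

lemma child_tableau_node: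
  assumes "child u v" "tableau_node u"
  shows "tableau_node v"
  using assms(1)
proof (cases rule: child_cases)
  case (expand \<psi> \<Delta>)
  have "a \<le> snd u \<and> snd u \<le> b" if op: "(True, J, a, b, d) \<in> node_ops v" for J a b d
  proof -
    have "(True, J, a, b, d) \<in> node_ops u \<or> a \<le> snd u \<and> snd u \<le> b"
    proof -
      from op obtain \<xi> where \<xi>: "\<xi> \<in> fst u \<or> \<xi> \<in> \<Delta>" "(True, J, a, b, d) \<in> ops \<xi>"
        by (auto simp: node_ops_def expand(3))
      from \<xi>(1) show ?thesis
      proof
        assume "\<xi> \<in> fst u"
        then show ?thesis using \<xi>(2) by (auto simp: node_ops_def)
      next
        assume "\<xi> \<in> \<Delta>"
        then have "(True, J, a, b, d) \<in> ops \<psi> \<or> a \<le> snd u \<and> snd u \<le> b"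
          using expansion_ops[OF expand(2) _ \<xi>(2)] by auto
        then show ?thesis using expand(1) by (auto simp: node_ops_def)
      qed
    qed
    then show ?thesis using assms(2) unfolding tableau_node_def by blast
  qed
  then show ?thesis
    using expand assms(2) expansion_weight[OF expand(2)] by (auto simp: tableau_node_def)
next
  case step
  have "finite (fst v)"
    using step(2) assms(2) finite_subset[OF step_node_subset]
    by (cases u) (auto simp: tableau_node_def)
  then show ?thesis using step_node_ops unfolding step tableau_node_def by blast
next
  case jump
  have "finite (fst v)"
    using jump(2) assms(2) finite_subset[OF jump_node_subset]
    by (cases u) (auto simp: tableau_node_def)
  then show ?thesis using jump_node_ops unfolding jump tableau_node_def by blast
qed

section \<open>Absence of infinite branches\<close>

lemma no_infinite_branch:
  fixes f :: "nat \<Rightarrow> 'n::finite node"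
  assumes node: "tableau_node (f 0)" and child: "\<And>i. child (f i) (f (Suc i))"
  shows False
proof -
  define T where "T i = snd (f i)" for i
  have nodes: "tableau_node (f i)" for i
  proof (induction i)
    case (Suc i)
    then show ?case by (rule child_tableau_node[OF child])
  qed (rule node)
  then have fin: "finite (fst (f i))" for i
    by (simp add: tableau_node_def)
  have time: "T i < T (Suc i) \<or> T (Suc i) = T i \<and> node_weight (f (Suc i)) < node_weight (f i)"
    for i
    unfolding T_def by (rule child_time[OF child fin])
  have "T i \<le> T (Suc i)" for i
    using time[of i] by linarith
  then have mono: "i \<le> j \<Longrightarrow> T i \<le> T j" for i j
    by (rule lift_Suc_mono_le)
  \<comment> \<open>If time stood still from \<open>I\<close> on, the weights would decrease
    forever.\<close>
  have advance: "\<exists>i\<ge>I. T i < T (Suc i)" for I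
  proof (rule ccontr)
    assume "\<not> ?thesis"
    then have "\<not> T (I + i) < T (Suc (I + i))" for i
      by (meson le_add1)
    then have "node_weight (f (I + Suc i)) < node_weight (f (I + i))" for i
      using time[of "I + i"] by simp
    moreover obtain i
      where "(node_weight (f (I + Suc i)), node_weight (f (I + i))) \<notin> {(x, y). x < y}"
      by (rule wf_no_infinite_down_chainE[OF wf_less])
    ultimately show False by blast
  qed
  have unbounded: "\<exists>I. \<forall>i\<ge>I. B < T i" for B
  proof (induction B)
    case 0
    obtain i where "T i < T (Suc i)" using advance[of 0] by blast
    then have "0 < T (Suc i)" by simp
    then show ?case using mono by (meson less_le_trans)
  next
    case (Suc B)
    then obtain I where "\<forall>i\<ge>I. B < T i" by blast
    moreover obtain i where "i \<ge> I" "T i < T (Suc i)" using advance by blast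
    ultimately have "Suc B < T (Suc i)" by fastforce
    then show ?case using mono by (meson less_le_trans)
  qed
  \<comment> \<open>The downward induction on \<open>n\<close> starts above all ranks that occur and
    ends with \<open>past 0 I\<close>, which concerns every operator.\<close>
  define past where
    "past n I \<longleftrightarrow> (\<forall>i\<ge>I. \<forall>m J a b d. (m, J, a, b, d) \<in> node_ops (f i) \<longrightarrow> n \<le> d \<longrightarrow>
       a < T i \<and> b < T i)" for n I
  have pastD: "a < T i \<and> b < T i"
    if "past n I" "I \<le> i" "(m, J, a, b, d) \<in> node_ops (f i)" "n \<le> d" for n I i m J a b d
    using that unfolding past_def by blast
  \<comment> \<open>A fresh operator would need one of rank at least \<open>Suc n\<close> whose
    interval contains \<open>T i\<close>, against \<open>past (Suc n) I\<close>.\<close>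
  have origin: "\<exists>m a b. (m, J, a, b, d) \<in> node_ops (f i) \<and> (in_sup (T i) J \<or> a' = a \<and> b' = b)"
    if "past (Suc n) I" "I \<le> i" "(m', J, a', b', d) \<in> node_ops (f (Suc i))" "n \<le> d"
    for n I i m' J a' b' d
    using child_ops[OF child that(3)]
  proof
    assume "\<exists>m J\<^sub>2 a b d\<^sub>2. (m, J\<^sub>2, a, b, d\<^sub>2) \<in> node_ops (f i) \<and> d < d\<^sub>2 \<and>
      a \<le> snd (f i) \<and> snd (f i) \<le> b"
    then obtain m J\<^sub>2 a b d\<^sub>2
      where op: "(m, J\<^sub>2, a, b, d\<^sub>2) \<in> node_ops (f i)" "d < d\<^sub>2" "T i \<le> b"
      by (auto simp: T_def)
    then have "b < T i" using that(4) pastD[OF that(1,2) op(1)] by simp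
    then show ?thesis using op(3) by simp
  qed (simp add: T_def)
  have past_step: "\<exists>I. past n I" if pastI: "past (Suc n) I" for n I
  proof -
    \<comment> \<open>By \<open>origin\<close>, superscripts are inherited, so those at
      \<open>I\<close> bound all later ones of rank at least \<open>n\<close>. That
      \<open>nat\<close> sends -1 to 0 is harmless for an upper bound.\<close>
    define S where "S = (\<lambda>(m, J, a, b, d). nat (snd J)) ` node_ops (f I)"
    have "finite S" unfolding S_def using finite_node_ops[OF fin] by blast
    then obtain s where s: "\<And>x. x \<in> S \<Longrightarrow> x \<le> s" using Max_ge by blast
    have sup: "snd J \<le> int s"
      if "I \<le> i" "(m, J, a, b, d) \<in> node_ops (f i)" "n \<le> d" for i m J a b d
      using that
    proof (induction i arbitrary: m a b rule: dec_induct)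
      case base
      then have "nat (snd J) \<in> S" unfolding S_def by force
      then show ?case using s by fastforce
    next
      case (step i)
      then show ?case using origin[OF pastI step.hyps(1) step.prems] by blast
    qed
    obtain I\<^sub>1 where I\<^sub>1: "\<And>i. I\<^sub>1 \<le> i \<Longrightarrow> s < T i" using unbounded by blast
    define I\<^sub>2 where "I\<^sub>2 = max I I\<^sub>1"
    \<comment> \<open>From here on time exceeds the relevant superscripts, so JUMP shifts no
      interval of rank at least \<open>n\<close>, and the present end points bound all later
      ones.\<close>
    define E where "E = (\<lambda>(m, J, a, b, d). max a b) ` node_ops (f I\<^sub>2)"
    have "finite E" unfolding E_def using finite_node_ops[OF fin] by blast
    then obtain e where e: "\<And>x. x \<in> E \<Longrightarrow> x \<le> e" using Max_ge by blast
    have bound: "a \<le> e \<and> b \<le> e"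
      if "I\<^sub>2 \<le> i" "(m, J, a, b, d) \<in> node_ops (f i)" "n \<le> d" for i m J a b d
      using that
    proof (induction i arbitrary: m a b rule: dec_induct)
      case base
      then have "max a b \<in> E" unfolding E_def by force
      then show ?case using e by fastforce
    next
      case (step i)
      have i: "I \<le> i" "s < T i" using step(1) I\<^sub>1 by (auto simp: I\<^sub>2_def)
      then obtain m' a' b' where op: "(m', J, a', b', d) \<in> node_ops (f i)"
        "in_sup (T i) J \<or> a = a' \<and> b = b'"
        using origin[OF pastI i(1) step.prems] by blast
      have "\<not> in_sup (T i) J"
        using sup[OF i(1) op(1) \<open>n \<le> d\<close>] i(2) by (simp add: in_sup_def)
      then show ?case using op step.IH \<open>n \<le> d\<close> by blast
    qed
    obtain I\<^sub>3 where "\<And>i. I\<^sub>3 \<le> i \<Longrightarrow> e < T i" using unbounded by blast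
    then have "past n (max I\<^sub>2 I\<^sub>3)"
      unfolding past_def using bound by (meson le_less_trans max.boundedE)
    then show ?thesis ..
  qed
  \<comment> \<open>Ranks never grow along the branch, so \<open>past (Suc s) 0\<close> holds
    vacuously for a bound \<open>s\<close> on the ranks in \<open>f 0\<close>.\<close>
  have "\<exists>n. past n 0"
  proof -
    define S where "S = (\<lambda>(m, J, a, b, d). d) ` node_ops (f 0)"
    have "finite S" unfolding S_def using finite_node_ops[OF fin] by blast
    then obtain s where s: "\<And>x. x \<in> S \<Longrightarrow> x \<le> s" using Max_ge by blast
    have "d \<le> s" if "(m, J, a, b, d) \<in> node_ops (f i)" for i m J a b d
      using that
    proof (induction i arbitrary: m J a b d)
      case 0
      then show ?case using s unfolding S_def by force
    next
      case (Suc i)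
      from child_ops[OF child Suc.prems] obtain m' J' a' b' d'
        where "(m', J', a', b', d') \<in> node_ops (f i)" "d \<le> d'"
        by (meson less_imp_le order_refl)
      then show ?case using Suc.IH by (meson le_trans)
    qed
    then have "past (Suc s) 0" unfolding past_def by (meson not_less_eq_eq)
    then show ?thesis ..
  qed
  then obtain n where "\<exists>I. past n I" by blast
  then have "\<exists>I. past 0 I"
  proof (induction n)
    case (Suc n)
    then show ?case using past_step by blast
  qed
  then obtain I where I: "past 0 I" ..
  \<comment> \<open>At a step that advances time the rule is not expansion. STEP needs a marked
    operator, JUMP an end point after \<open>T i\<close>; neither exists when all operators are
    past.\<close>
  obtain i where i: "I \<le> i" "T i < T (Suc i)" using advance by blast
  have dead: "a < T i \<and> b < T i" if "NTemp m B J a b p q \<in> fst (f i)" for m B J a b p q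
    using pastD[OF I i(1) _ le0] node_opsI[OF that, of "snd (f i)"] by simp
  show False
    using child[of i]
  proof (cases rule: child_cases)
    case expand
    then show False using i(2) by (simp add: T_def)
  next
    case step
    then obtain B J a b p q where op: "NTemp True B J a b p q \<in> fst (f i)"
      unfolding step_applies_def by (cases "f i") auto
    then have "T i \<le> b"
      using nodes[of i] node_opsI[OF op, of "snd (f i)"]
      unfolding tableau_node_def T_def prod.collapse by blast
    then show False using dead[OF op] by simp
  next
    case jump
    then show False
      using dead unfolding jump_times_def T_def by (cases "f i") fastforce
  qed
qed

section \<open>From branches to trees\<close>

lemma wf_child: "wf {(v, u). tableau_node u \<and> child (u :: 'n::finite node) v}"
  unfolding wf_iff_no_infinite_down_chain
proof
  assume "\<exists>f. \<forall>i. (f (Suc i), f i) \<in> {(v, u). tableau_node u \<and> child (u :: 'n node) v}"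
  then obtain f :: "nat \<Rightarrow> 'n node" where "\<And>i. tableau_node (f i) \<and> child (f i) (f (Suc i))"
    by auto
  then show False using no_infinite_branch by blast
qed

text \<open>Well-founded induction along \<open>child\<close>: a tree is its root and one subtree
  per entry of \<open>cs\<close>. The subtree at \<open>i\<close> has the assumed form after
  prefixing positions with \<open>i\<close>, so \<open>N\<close> and \<open>L\<close> are
  generalised.\<close>

lemma finite_tableau:
  fixes u :: "'n::finite node"
  assumes "tableau_node u" "L [] = u" "[] \<in> N"
    and "\<And>p i. p @ [i] \<in> N \<Longrightarrow> p \<in> N"
    and "\<And>p. p \<in> N \<Longrightarrow> \<exists>cs. children (L p) cs \<and>
        (\<forall>i. p @ [i] \<in> N \<longleftrightarrow> i < length cs) \<and> (\<forall>i<length cs. L (p @ [i]) = cs ! i)"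
  shows "finite N"
  using assms
proof (induction u arbitrary: N L rule: wf_induct_rule[OF wf_child])
  case (1 u)
  note closed = 1(5) and local = 1(6)
  obtain cs where cs: "children u cs" "\<And>i. [i] \<in> N \<longleftrightarrow> i < length cs"
    "\<And>i. i < length cs \<Longrightarrow> L [i] = cs ! i"
    using local[OF 1(4)] 1(3) by auto
  \<comment> \<open>\<open>closed\<close> drops only the last index of a position, hence the
    induction from the end of \<open>p\<close>.\<close>
  have first: "[i] \<in> N" if "i # p \<in> N" for i p
    using that
  proof (induction p rule: rev_induct)
    case (snoc j p)
    then show ?case using closed[of "i # p" j] by simp
  qed
  have subtree: "finite {p. i # p \<in> N}" if i: "i < length cs" for i
  proof (rule 1(1)[where y = "cs ! i" and L = "\<lambda>p. L (i # p)"])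
    have "child u (cs ! i)" using cs(1) i by (auto simp: child_def)
    then show "(cs ! i, u) \<in> {(v, u). tableau_node u \<and> child u v}" "tableau_node (cs ! i)"
      using 1(2) child_tableau_node[of u "cs ! i"] by auto
    show "p \<in> {p. i # p \<in> N}" if "p @ [j] \<in> {p. i # p \<in> N}" for p j
      using that closed[of "i # p" j] by simp
    show "\<exists>cs. children (L (i # p)) cs \<and>
        (\<forall>j. p @ [j] \<in> {p. i # p \<in> N} \<longleftrightarrow> j < length cs) \<and>
        (\<forall>j<length cs. L (i # p @ [j]) = cs ! j)" if "p \<in> {p. i # p \<in> N}" for p
      using local[of "i # p"] that by simp
  qed (use cs i in auto)
  have "N \<subseteq> insert [] (\<Union>i<length cs. (#) i ` {p. i # p \<in> N})"
  proof
    fix p assume "p \<in> N"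
    then show "p \<in> insert [] (\<Union>i<length cs. (#) i ` {p. i # p \<in> N})"
      using first cs(2) by (cases p) auto
  qed
  then show ?case
    by (rule finite_subset) (use subtree in auto)
qed

theorem theorem4p2:
  fixes \<phi> :: "'n::finite stl"
    and N :: "nat list set"
    and L :: "nat list \<Rightarrow> 'n node"
  assumes "stl_wf \<phi>"
    and "strict_normal_form \<phi>"
    and "complete_tableau \<phi> N L"
  shows "finite N"
proof -
  \<comment> \<open>\<open>temp_exp\<close> creates only unmarked operators, so the interval
    condition is vacuous.\<close>
  have "tableau_node (root_node \<phi>)"
    using ops_temp_exp by (fastforce simp: tableau_node_def node_ops_def root_node_def)
  then show ?thesis
    by (rule finite_tableau[where L = L]) (use assms(3) in \<open>auto simp: complete_tableau_def\<close>)
qed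

end
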